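(* Assume that $\mathcal H_N=\operatorname{span}\{\psi_1,\dots,\psi_N\}$ is $\mathcal K$-invariant, that (R1) $G_\Psi=\mathbb E_\mu[\Psi\Psi^*]\succ0$, that (R2) $\mathbb E[\Psi(x)u^*]=\mathbb E_\mu[\Psi(x)]\mathbb E_\nu[u]^*$ with $\mathbb E_\nu[u]=0$, and that the eigenvalues of the Koopman realisation $A\in\mathbb C^{N\times N}$ satisfy $|\lambda_i(A)-\lambda_j(A)|\ge\Delta$ for all $i\ne j$ and some $\Delta>0$. Let $\{\Pi_k=v_k\phi_k^\top\}_{k=1}^N$ be the spectral projectors of $A$, let $\mu_1,\dots,\mu_{r^*}$ be its distinct eigenvalues, and let $\mathcal A(A):=\mathbb C[A]\subseteq\mathbb C^{N\times N}$ be the algebra of polynomials in $A$. Then: (a) $\mathcal A(A)$ is a commutative unital $\mathbb C$-algebra of dimension $r^*$, spanned by the spectral projectors after identification of projectors sharing an eigenvalue. (b) The evaluation map $p(A)\mapsto(p(\mu_1),\dots,p(\mu_{r^*}))$ is an isomorphism $\mathcal A(A)\cong\mathbb C^{r^*}$ of commutative unital $\mathbb C$-algebras. The pullback of pointwise conjugation on $\mathbb C^{r^*}$ endows $\mathcal A(A)$ with an involution under which it becomes a commutative $*$-algebra isomorphic to $\mathbb C^{r^*}$. (c) For any additive perturbation $\delta\in\mathbb C^N$ at layer $\ell_0$, its downstream effect at layer $\ell>\ell_0$ is $$A^{\ell-\ell_0}\delta=\sum_{k=1}^N\lambda_k^{\ell-\ell_0}\,\Pi_k\,\delta.$$ (d)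 Each of activation patching, path patching, attribution patching and mean ablation (encoded as an additive perturbation as in the context) has a unique closed-form representative in $\mathcal A(A)$, obtained by the spectral decomposition $\delta=\sum_k\Pi_k\delta$.
   Context: $\mathcal X\subseteq\mathbb R^d$ is the state space, $\mathcal U\subseteq\mathbb R^p$ the control space, and $F:\mathcal X\times\mathcal U\to\mathcal X$ is the transformer layer map $F(x,u)=x+u+m(x+u)$, with $m=\mathrm{MLP}\circ\mathrm{RMSNorm}$ the MLP sublayer. $\mu,\nu$ are probability measures on $\mathcal X,\mathcal U$ and $(x,u)\sim\mu\otimes\nu$ (the measure $\mu$ is not to be confused with the eigenvalues $\mu_k$). $\Psi=(\psi_1,\dots,\psi_N)^\top$ with $\psi_i\in L^2(\mathcal X,\mu)$. $\mathcal K$-invariance: for every $\psi\in\mathcal H_N$ and every $u\in\mathcal U$, $x\mapsto\psi(F(x,u))$ belongs to $\mathcal H_N$. The Koopman realisation $A$ is the unique matrix with $A\Psi(x)=\mathbb E_{u\sim\nu}[\Psi(F(x,u))]$ $\mu$-a.e. $v_k$ and $\phi_k$ are right and left eigenvectors of $A$: $Av_k=\lambda_kv_k$, $\phi_k^\top A=\lambda_k\phi_k^\top$, normalised so that $\phi_j^\top v_k=\delta_{jk}$. In the lifted linear dynamics a perturbation $\delta\in\mathbb C^N$ added to the observable at layer $\ell_0$ has downstream effect $A^{\ell-\ell_0}\delta$ at layer $\ell$. The interventions of (d) are encoded as follows, where $x_{\ell_0}$ is the state at layer $\ell_0$: activation patching with $x'_{\ell_0}$: $\delta=\Psi(x'_{\ell_0})-\Psi(x_{\ell_0})$;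 path patching restricted to a subset $S$ of modes: $\delta_S=\sum_{k\in S}\Pi_k\delta$; attribution patching with a linear read-out $C\in\mathbb C^{q\times N}$: the linearised downstream effect $CA^{\ell-\ell_0}\delta=\sum_k\lambda_k^{\ell-\ell_0}C\Pi_k\delta$; mean ablation: $\delta=\Psi(\bar x)-\Psi(x_{\ell_0})$, $\bar x$ the mean state. The representative is the expansion in the basis $\{\Pi_k\}$ of $\mathcal A(A)$. *)

theory Defs
  imports
    "HOL-Probability.Probability"
    "HOL-Computational_Algebra.Polynomial"
begin

section \<open>The transformer layer map\<close>

definition rms_norm :: "real^'d \<Rightarrow> real \<Rightarrow> real^'d \<Rightarrow> real^'d" where
  "rms_norm gain eps x =
     (\<chi> i. gain $ i * x $ i / sqrt ((\<Sum>j\<in>UNIV. (x $ j)\<^sup>2) / real CARD('d) + eps))"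

text \<open>The architecture of the MLP (depth, width, activation, gating) plays no role, so
  \<open>mlp\<close> is an arbitrary map. Adding \<open>u\<close> to \<open>x\<close> forces the control space to lie in the same
  \<open>real^'d\<close> as the state space.\<close>

definition layer_map ::
    "(real^'d \<Rightarrow> real^'d) \<Rightarrow> real^'d \<Rightarrow> real \<Rightarrow> real^'d \<Rightarrow> real^'d \<Rightarrow> real^'d" where
  "layer_map mlp gain eps x u = x + u + mlp (rms_norm gain eps (x + u))"


section \<open>Observables and the Koopman realisation\<close>

text \<open>The \<open>i\<close>-th observable is \<open>\<lambda>x. Psi x $ i\<close>.\<close>

definition square_integrable_obs :: "'x measure \<Rightarrow> ('x \<Rightarrow> complex^'n) \<Rightarrow> bool" where
  "square_integrable_obs M Psi \<longleftrightarrow>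
     (\<forall>i. (\<lambda>x. Psi x $ i) \<in> borel_measurable M \<and> integrable M (\<lambda>x. (cmod (Psi x $ i))\<^sup>2))"

definition obs_span :: "('x \<Rightarrow> complex^'n) \<Rightarrow> ('x \<Rightarrow> complex) set" where
  "obs_span Psi = {f. \<exists>c. f = (\<lambda>x. \<Sum>i\<in>UNIV. c i * Psi x $ i)}"

text \<open>Membership of \<open>\<lambda>x. \<psi> (F x u)\<close> in the span is membership in \<open>L\<^sup>2\<close>, hence up to a null set.\<close>

definition koopman_invariant ::
    "'x measure \<Rightarrow> 'u set \<Rightarrow> ('x \<Rightarrow> 'u \<Rightarrow> 'x) \<Rightarrow> ('x \<Rightarrow> complex^'n) \<Rightarrow> bool" where
  "koopman_invariant M U F Psi \<longleftrightarrow>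
     (\<forall>f\<in>obs_span Psi. \<forall>u\<in>U. \<exists>g\<in>obs_span Psi. AE x in M. f (F x u) = g x)"

definition gram :: "'x measure \<Rightarrow> ('x \<Rightarrow> complex^'n) \<Rightarrow> complex^'n^'n" where
  "gram M Psi = (\<chi> i j. \<integral>x. Psi x $ i * cnj (Psi x $ j) \<partial>M)"

definition pos_definite :: "complex^'n^'n \<Rightarrow> bool" where
  "pos_definite G \<longleftrightarrow>
     (\<forall>i j. G $ i $ j = cnj (G $ j $ i)) \<and>
     (\<forall>z. z \<noteq> 0 \<longrightarrow> 0 < Re (\<Sum>i\<in>UNIV. \<Sum>j\<in>UNIV. cnj (z $ i) * G $ i $ j * z $ j))"

text \<open>Controls are real vectors, so \<open>u\<^sup>*\<close> is the transpose of \<open>u\<close>.\<close>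

definition uncorrelated_centred_control ::
    "'x measure \<Rightarrow> (real^'d) measure \<Rightarrow> ('x \<Rightarrow> complex^'n) \<Rightarrow> bool" where
  "uncorrelated_centred_control M N Psi \<longleftrightarrow>
     integrable N (\<lambda>u. u) \<and> (\<integral>u. u \<partial>N) = 0 \<and>
     (\<forall>i j. (\<integral>p. Psi (fst p) $ i * of_real (snd p $ j) \<partial>(M \<Otimes>\<^sub>M N)) =
            (\<integral>x. Psi x $ i \<partial>M) * of_real ((\<integral>u. u \<partial>N) $ j))"

definition realises_koopman ::
    "'x measure \<Rightarrow> 'u measure \<Rightarrow> ('x \<Rightarrow> 'u \<Rightarrow> 'x) \<Rightarrow> ('x \<Rightarrow> complex^'n)
      \<Rightarrow> complex^'n^'n \<Rightarrow> bool" where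
  "realises_koopman M N F Psi A \<longleftrightarrow>
     (AE x in M. integrable N (\<lambda>u. Psi (F x u)) \<and> A *v Psi x = (\<integral>u. Psi (F x u) \<partial>N))"

definition koopman_realisation ::
    "'x measure \<Rightarrow> 'u measure \<Rightarrow> ('x \<Rightarrow> 'u \<Rightarrow> 'x) \<Rightarrow> ('x \<Rightarrow> complex^'n)
      \<Rightarrow> complex^'n^'n \<Rightarrow> bool" where
  "koopman_realisation M N F Psi A \<longleftrightarrow>
     realises_koopman M N F Psi A \<and> (\<forall>B. realises_koopman M N F Psi B \<longrightarrow> B = A)"


section \<open>Complex matrices, polynomials in a matrix, spectral data\<close>

text \<open>The library provides matrices over a field with their additive and real-linear structure
  only; complex scalar multiplication is needed for complex span and dimension.\<close>

definition cscale :: "complex \<Rightarrow> complex^'n^'m \<Rightarrow> complex^'n^'m" where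
  "cscale c M = (\<chi> i j. c * M $ i $ j)"

interpretation cmat: vector_space "cscale :: complex \<Rightarrow> complex^'n^'m \<Rightarrow> complex^'n^'m"
  by unfold_locales (simp_all add: cscale_def vec_eq_iff algebra_simps)

text \<open>Powers are taken with respect to \<open>**\<close>; the type class operation \<open>^\<close> on \<open>complex^'n^'n\<close> is
  the entrywise power.\<close>

primrec mat_pow :: "complex^'n^'n \<Rightarrow> nat \<Rightarrow> complex^'n^'n" where
  "mat_pow A 0 = mat 1"
| "mat_pow A (Suc k) = A ** mat_pow A k"

definition mat_poly :: "complex poly \<Rightarrow> complex^'n^'n \<Rightarrow> complex^'n^'n" where
  "mat_poly p A = (\<Sum>k\<le>degree p. cscale (coeff p k) (mat_pow A k))"

definition poly_algebra :: "complex^'n^'n \<Rightarrow> (complex^'n^'n) set" where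
  "poly_algebra A = range (\<lambda>p. mat_poly p A)"

definition spectrum :: "complex^'n^'n \<Rightarrow> complex set" where
  "spectrum A = {z. \<exists>v. v \<noteq> 0 \<and> A *v v = z *s v}"

text \<open>\<open>lam\<close> lists the eigenvalues with algebraic multiplicity: the characteristic polynomial
  is the product of the \<open>z - lam i\<close>.\<close>

definition eigenvalue_list :: "complex^'n^'n \<Rightarrow> ('n \<Rightarrow> complex) \<Rightarrow> bool" where
  "eigenvalue_list A lam \<longleftrightarrow> (\<forall>z. det (mat z - A) = (\<Prod>i\<in>UNIV. z - lam i))"

text \<open>The pairing of left and right eigenvectors is bilinear (no conjugation).\<close>

definition biorthonormal_eigenvectors ::
    "complex^'n^'n \<Rightarrow> ('n \<Rightarrow> complex) \<Rightarrow> ('n \<Rightarrow> complex^'n) \<Rightarrow> ('n \<Rightarrow> complex^'n) \<Rightarrow> bool" where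
  "biorthonormal_eigenvectors A lam v phi \<longleftrightarrow>
     (\<forall>k. A *v v k = lam k *s v k) \<and>
     (\<forall>k. phi k v* A = lam k *s phi k) \<and>
     (\<forall>j k. (\<Sum>i\<in>UNIV. phi j $ i * v k $ i) = (if j = k then 1 else 0))"

definition spectral_projector ::
    "('n \<Rightarrow> complex^'n) \<Rightarrow> ('n \<Rightarrow> complex^'n) \<Rightarrow> 'n \<Rightarrow> complex^'n^'n" where
  "spectral_projector v phi k = (\<chi> i j. v k $ i * phi k $ j)"

text \<open>Identification of the projectors sharing the eigenvalue \<open>z\<close>.\<close>

definition grouped_projector ::
    "('n \<Rightarrow> complex) \<Rightarrow> ('n \<Rightarrow> complex^'n^'n) \<Rightarrow> complex \<Rightarrow> complex^'n^'n" where
  "grouped_projector lam P z = (\<Sum>k | lam k = z. P k)"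


section \<open>Algebras and *-algebras of matrices\<close>

definition comm_unital_algebra :: "(complex^'n^'n) set \<Rightarrow> bool" where
  "comm_unital_algebra S \<longleftrightarrow>
     cmat.subspace S \<and> mat 1 \<in> S \<and>
     (\<forall>X\<in>S. \<forall>Y\<in>S. X ** Y \<in> S \<and> X ** Y = Y ** X)"

text \<open>The operations of \<open>complex^'r\<close> are pointwise, also \<open>*\<close> and \<open>1\<close>.\<close>

definition algebra_iso ::
    "(complex^'n^'n) set \<Rightarrow> (complex^'n^'n \<Rightarrow> complex^'r) \<Rightarrow> bool" where
  "algebra_iso S f \<longleftrightarrow>
     bij_betw f S UNIV \<and> f (mat 1) = 1 \<and>
     (\<forall>X\<in>S. \<forall>Y\<in>S. f (X + Y) = f X + f Y \<and> f (X ** Y) = f X * f Y) \<and>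
     (\<forall>c. \<forall>X\<in>S. f (cscale c X) = c *s f X)"

definition algebra_involution ::
    "(complex^'n^'n) set \<Rightarrow> (complex^'n^'n \<Rightarrow> complex^'n^'n) \<Rightarrow> bool" where
  "algebra_involution S st \<longleftrightarrow>
     (\<forall>X\<in>S. st X \<in> S \<and> st (st X) = X) \<and>
     (\<forall>X\<in>S. \<forall>Y\<in>S. st (X + Y) = st X + st Y \<and> st (X ** Y) = st Y ** st X) \<and>
     (\<forall>c. \<forall>X\<in>S. st (cscale c X) = cscale (cnj c) (st X))"

definition vec_cnj :: "complex^'r \<Rightarrow> complex^'r" where
  "vec_cnj w = (\<chi> j. cnj (w $ j))"

definition star_algebra_iso ::
    "(complex^'n^'n) set \<Rightarrow> (complex^'n^'n \<Rightarrow> complex^'n^'n) \<Rightarrow> (complex^'n^'n \<Rightarrow> complex^'r) \<Rightarrow> bool"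
  where
  "star_algebra_iso S st f \<longleftrightarrow> algebra_iso S f \<and> (\<forall>X\<in>S. f (st X) = vec_cnj (f X))"

text \<open>The choice of a polynomial representing \<open>X\<close> is immaterial when the entries of \<open>eig\<close> are
  eigenvalues of \<open>A\<close>; that is the well-definedness of \<open>p(A) \<mapsto> (p(eig j))\<^sub>j\<close>.\<close>

definition eval_map :: "complex^'n^'n \<Rightarrow> ('r \<Rightarrow> complex) \<Rightarrow> complex^'n^'n \<Rightarrow> complex^'r" where
  "eval_map A eig X = (\<chi> j. poly (SOME p. mat_poly p A = X) (eig j))"

definition pullback_cnj ::
    "(complex^'n^'n) set \<Rightarrow> (complex^'n^'n \<Rightarrow> complex^'r) \<Rightarrow> complex^'n^'n \<Rightarrow> complex^'n^'n" where
  "pullback_cnj S f X = the_inv_into S f (vec_cnj (f X))"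


section \<open>Lifted linear dynamics and interventions\<close>

primrec lifted_flow :: "complex^'n^'n \<Rightarrow> nat \<Rightarrow> complex^'n \<Rightarrow> complex^'n" where
  "lifted_flow A 0 z = z"
| "lifted_flow A (Suc k) z = A *v lifted_flow A k z"

text \<open>Perturbed minus unperturbed trajectory at layer \<open>l\<close>, where \<open>z\<close> is the value of the
  observable at layer \<open>l0\<close>.\<close>

definition downstream_effect ::
    "complex^'n^'n \<Rightarrow> nat \<Rightarrow> nat \<Rightarrow> complex^'n \<Rightarrow> complex^'n \<Rightarrow> complex^'n" where
  "downstream_effect A l0 l z \<delta> =
     lifted_flow A (l - l0) (z + \<delta>) - lifted_flow A (l - l0) z"

definition activation_patch :: "('x \<Rightarrow> complex^'n) \<Rightarrow> 'x \<Rightarrow> 'x \<Rightarrow> complex^'n" where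
  "activation_patch Psi x x' = Psi x' - Psi x"

definition path_patch ::
    "('n \<Rightarrow> complex^'n^'n) \<Rightarrow> 'n set \<Rightarrow> complex^'n \<Rightarrow> complex^'n" where
  "path_patch P S \<delta> = (\<Sum>k\<in>S. P k *v \<delta>)"

definition attribution_effect ::
    "complex^'n^'n \<Rightarrow> complex^'n^'q \<Rightarrow> nat \<Rightarrow> nat \<Rightarrow> complex^'n \<Rightarrow> complex^'q" where
  "attribution_effect A C l0 l \<delta> = C *v (mat_pow A (l - l0) *v \<delta>)"

definition mean_state :: "(real^'d) measure \<Rightarrow> real^'d" where
  "mean_state M = (\<integral>x. x \<partial>M)"

definition mean_ablation ::
    "(real^'d) measure \<Rightarrow> (real^'d \<Rightarrow> complex^'n) \<Rightarrow> real^'d \<Rightarrow> complex^'n" where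
  "mean_ablation M Psi x = Psi (mean_state M) - Psi x"

definition modal_expansion ::
    "('n \<Rightarrow> complex^'n^'n) \<Rightarrow> complex^'n \<Rightarrow> ('n \<Rightarrow> complex^'n) \<Rightarrow> bool" where
  "modal_expansion P y w \<longleftrightarrow> (\<forall>k. w k \<in> range (\<lambda>a. P k *v a)) \<and> y = (\<Sum>k\<in>UNIV. w k)"

definition unique_modal_expansion ::
    "('n \<Rightarrow> complex^'n^'n) \<Rightarrow> complex^'n \<Rightarrow> ('n \<Rightarrow> complex^'n) \<Rightarrow> bool" where
  "unique_modal_expansion P y w \<longleftrightarrow>
     modal_expansion P y w \<and> (\<forall>w'. modal_expansion P y w' \<longrightarrow> w' = w)"

text \<open>What it means for a matrix to represent an intervention: it maps every raw perturbation
  \<open>\<delta>\<close> to the effect. Quantifying over all \<open>\<delta>\<close> (and all read-outs \<open>C\<close>) is essential for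
  uniqueness: a single \<open>\<delta>\<close> may lack some modes, and differences \<open>Psi x' - Psi x\<close> always lack a
  mode if the constants belong to the span of the observables.\<close>

definition represents_patching :: "complex^'n^'n \<Rightarrow> nat \<Rightarrow> nat \<Rightarrow> complex^'n^'n \<Rightarrow> bool" where
  "represents_patching A l0 l R \<longleftrightarrow> (\<forall>z \<delta>. downstream_effect A l0 l z \<delta> = R *v \<delta>)"

definition represents_path_patching ::
    "complex^'n^'n \<Rightarrow> ('n \<Rightarrow> complex^'n^'n) \<Rightarrow> 'n set \<Rightarrow> nat \<Rightarrow> nat \<Rightarrow> complex^'n^'n \<Rightarrow> bool" where
  "represents_path_patching A P S l0 l R \<longleftrightarrow>
     (\<forall>z \<delta>. downstream_effect A l0 l z (path_patch P S \<delta>) = R *v \<delta>)"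

definition represents_attribution ::
    "'q::finite itself \<Rightarrow> complex^'n^'n \<Rightarrow> nat \<Rightarrow> nat \<Rightarrow> complex^'n^'n \<Rightarrow> bool" where
  "represents_attribution _ A l0 l R \<longleftrightarrow>
     (\<forall>(C :: complex^'n^'q) \<delta>. attribution_effect A C l0 l \<delta> = C *v (R *v \<delta>))"

text \<open>\<open>c\<close> is the coefficient vector, in the family \<open>P\<close>, of the one element of the algebra
  \<open>S\<close> with property \<open>rep\<close>.\<close>

definition unique_representative ::
    "(complex^'n^'n) set \<Rightarrow> ('n \<Rightarrow> complex^'n^'n) \<Rightarrow> (complex^'n^'n \<Rightarrow> bool)
      \<Rightarrow> ('n \<Rightarrow> complex) \<Rightarrow> bool" where
  "unique_representative S P rep c \<longleftrightarrow>
     (\<exists>R\<in>S. rep R \<and> (\<forall>R'\<in>S. rep R' \<longrightarrow> R' = R) \<and>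
        R = (\<Sum>k\<in>UNIV. cscale (c k) (P k)) \<and>
        (\<forall>c'. R = (\<Sum>k\<in>UNIV. cscale (c' k) (P k)) \<longrightarrow> c' = c))"

end

theory Submission
  imports Defs
begin

text \<open>The gap makes the eigenvalues \<open>lam k\<close> pairwise distinct, so Lagrange interpolation gives
  polynomials \<open>p\<close> with arbitrary values \<open>poly p (lam k)\<close>. Applied to a vanishing combination of
  eigenvectors they isolate one term; hence the eigenvectors form a basis, and the rows of the
  inverse of the matrix of columns \<open>v k\<close> are the dual left eigenvectors. A left inverse of a square
  matrix is a right inverse, so biorthonormality yields \<open>(\<Sum>k\<in>UNIV. P k) = mat 1\<close> and \<open>p(A)\<close> is the
  combination of the \<open>P k\<close> with coefficients \<open>poly p (lam k)\<close>. By interpolation again all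
  coefficient vectors occur, which identifies \<open>poly_algebra A\<close> with the functions on the index
  set under pointwise operations; all claims are read off there.\<close>

section \<open>Linearity of the matrix operations\<close>

lemma cscale_nth [simp]: "cscale c M $ i $ j = c * M $ i $ j"
  by (simp add: cscale_def)

lemma cscale_matrix_vector_mult: "cscale c M *v x = c *s (M *v x)"
  by (simp add: vec_eq_iff matrix_vector_mult_def sum_distrib_left mult.assoc)

lemma cscale_matrix_mult_left: "cscale c M ** N = cscale c (M ** N)"
  by (simp add: vec_eq_iff matrix_matrix_mult_def sum_distrib_left mult.assoc)

lemma cscale_matrix_mult_right: "M ** cscale c N = cscale c (M ** N)"
  by (simp add: vec_eq_iff matrix_matrix_mult_def sum_distrib_left mult.left_commute)

lemma sum_matrix_vector_mult: "(\<Sum>k\<in>S. M k) *v (x :: complex^'n) = (\<Sum>k\<in>S. M k *v x)"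
  by (induction S rule: infinite_finite_induct) (auto simp: matrix_vector_mult_add_rdistrib)

lemma matrix_vector_mult_sum: "(M :: complex^'n^'m) *v (\<Sum>k\<in>S. x k) = (\<Sum>k\<in>S. M *v x k)"
  by (induction S rule: infinite_finite_induct) (auto simp: matrix_vector_right_distrib)

lemma sum_matrix_mult: "(\<Sum>k\<in>S. M k) ** (N :: complex^'n^'m) = (\<Sum>k\<in>S. M k ** N)"
  by (simp add: vec_eq_iff matrix_matrix_mult_def sum_distrib_right) (intro allI sum.swap)

lemma matrix_mult_sum: "(M :: complex^'n^'m) ** (\<Sum>k\<in>S. N k) = (\<Sum>k\<in>S. M ** N k)"
  by (induction S rule: infinite_finite_induct) (auto simp: matrix_add_ldistrib)

section \<open>Polynomials in a matrix and Lagrange interpolation\<close>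

lemma mat_pow_eigenvector:
  assumes "A *v w = z *s w"
  shows "mat_pow A k *v w = z ^ k *s w"
  by (induction k)
    (simp_all add: assms vector_scalar_commute vec.scale_left_commute mult.commute
      flip: matrix_vector_mul_assoc)

lemma mat_poly_eigenvector:
  assumes "A *v w = z *s w"
  shows "mat_poly p A *v w = poly p z *s w"
  by (simp add: mat_poly_def sum_matrix_vector_mult cscale_matrix_vector_mult
      mat_pow_eigenvector[OF assms] poly_altdef vec.scale_sum_left)

lemma lagrange_interpolation:
  fixes lam c :: "'n::finite \<Rightarrow> 'a::field"
  assumes "inj lam"
  shows "\<exists>p. \<forall>k. poly p (lam k) = c k"
proof -
  \<comment> \<open>\<open>q i\<close> vanishes at every node except \<open>lam i\<close>; divided
    by its value there it is the Lagrange basis polynomial.\<close>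
  define q where "q i = (\<Prod>j\<in>UNIV - {i}. [:- lam j, 1:])" for i
  define p where "p = (\<Sum>i\<in>UNIV. smult (c i / poly (q i) (lam i)) (q i))"
  have q_off: "poly (q i) (lam k) = 0" if "k \<noteq> i" for i k
    using that by (auto simp: q_def poly_prod)
  have q_on: "poly (q k) (lam k) \<noteq> 0" for k
    using assms by (auto simp: q_def poly_prod inj_eq)
  have "poly p (lam k) = c k" for k
  proof -
    have "poly p (lam k) = (\<Sum>i\<in>UNIV. if i = k then c k else 0)"
      unfolding p_def poly_sum by (rule sum.cong) (auto simp: q_off q_on)
    then show ?thesis by simp
  qed
  then show ?thesis by blast
qed

section \<open>Eigenvectors of a matrix with simple spectrum\<close>

text \<open>A square matrix is singular iff its kernel is nontrivial. This links
  \<open>eigenvalue_list\<close>, given by a determinant, to \<open>spectrum\<close>, given by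
  eigenvectors.\<close>

lemma det_mat_diff_eq_0_iff:
  "det (mat z - A) = 0 \<longleftrightarrow> (\<exists>w. w \<noteq> 0 \<and> A *v w = z *s w)" for A :: "complex^'n^'n"
proof -
  have "(mat z - A) *v w = 0 \<longleftrightarrow> A *v w = z *s w" for w
  proof -
    have "mat z *v w = z *s w"
      by (simp add: vec_eq_iff matrix_vector_mult_def mat_def if_distrib[of "\<lambda>x. x * _"] cong: if_cong)
    then show ?thesis by (auto simp: matrix_vector_mult_diff_rdistrib)
  qed
  then show ?thesis
    using invertible_det_nz[of "mat z - A"] invertible_left_inverse[of "mat z - A"]
      matrix_left_invertible_ker[of "mat z - A"] by auto
qed

lemma spectrum_eq_range_eigenvalue_list:
  assumes "eigenvalue_list A lam"
  shows "spectrum A = range lam"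
proof -
  have "z \<in> spectrum A \<longleftrightarrow> (\<Prod>i\<in>UNIV. z - lam i) = 0" for z
    using assms by (simp add: spectrum_def eigenvalue_list_def flip: det_mat_diff_eq_0_iff)
  then show ?thesis by auto
qed

lemma biorthonormal_eigenvectors_exist:
  assumes lam: "eigenvalue_list A lam" and "inj lam"
  shows "\<exists>v phi. biorthonormal_eigenvectors A lam v phi"
proof -
  have "\<exists>w. w \<noteq> 0 \<and> A *v w = lam k *s w" for k
    using spectrum_eq_range_eigenvalue_list[OF lam] by (auto simp: spectrum_def)
  then obtain v where v_nz: "\<And>k. v k \<noteq> 0" and v: "\<And>k. A *v v k = lam k *s v k"
    by metis
  define V where "V = (\<chi> i k. v k $ i)"
  have V_apply: "V *v c = (\<Sum>k\<in>UNIV. c $ k *s v k)" for c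
    by (simp add: vec_eq_iff V_def matrix_vector_mult_def mult.commute)
  have "c = 0" if "V *v c = 0" for c
  proof -
    have "c $ i = 0" for i
    proof -
      obtain p where p: "\<And>k. poly p (lam k) = (if k = i then 1 else 0)"
        using lagrange_interpolation[OF \<open>inj lam\<close>, of "\<lambda>k. if k = i then 1 else 0"] by auto
      \<comment> \<open>With \<open>p\<close> equal to 1 at \<open>lam i\<close> and 0 at the other
        eigenvalues, \<open>p(A)\<close> keeps only the term \<open>c $ i *s v i\<close> of the
        combination.\<close>
      have "0 = mat_poly p A *v (V *v c)"
        using that by simp
      also have "\<dots> = (\<Sum>k\<in>UNIV. if k = i then c $ i *s v i else 0)"
        unfolding V_apply matrix_vector_mult_sum
        by (rule sum.cong) (auto simp: vector_scalar_commute mat_poly_eigenvector[OF v] p)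
      finally show ?thesis using v_nz[of i] by simp
    qed
    then show ?thesis by (simp add: vec_eq_iff)
  qed
  then obtain W where WV: "W ** V = mat 1"
    using matrix_left_invertible_ker[of V] by blast
  then have VW: "V ** W = mat 1"
    using matrix_left_right_inverse by blast
  \<comment> \<open>The right eigenvector equations read \<open>A ** V = V ** D\<close>. Multiplying
    by \<open>W\<close> on both sides gives \<open>W ** A = D ** W\<close>, so the rows of
    \<open>W\<close> are left eigenvectors; \<open>W ** V = mat 1\<close> is their
    biorthonormality.\<close>
  define D where "D = (\<chi> i j. if i = j then lam i else 0)"
  have "A ** V = V ** D"
  proof -
    have "(A ** V) $ i $ k = (A *v v k) $ i" for i k
      by (simp add: V_def matrix_matrix_mult_def matrix_vector_mult_def)
    moreover have "(V ** D) $ i $ k = lam k * v k $ i" for i k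
      by (simp add: V_def D_def matrix_matrix_mult_def if_distrib[of "\<lambda>x. _ * x"] mult.commute cong: if_cong)
    ultimately show ?thesis by (simp add: vec_eq_iff v)
  qed
  then have "W ** A = D ** W"
    by (metis VW WV matrix_mul_assoc matrix_mul_lid matrix_mul_rid)
  moreover have "(D ** W) $ k $ i = lam k * W $ k $ i" for i k
    by (simp add: D_def matrix_matrix_mult_def if_distrib[of "\<lambda>x. x * _"] cong: if_cong)
  moreover have "(W ** A) $ k = W $ k v* A" for k
    by (simp add: vec_eq_iff matrix_matrix_mult_def vector_matrix_mult_def mult.commute)
  ultimately have "W $ k v* A = lam k *s W $ k" for k
    by (metis (no_types, lifting) vec_eq_iff vector_smult_component)
  moreover have "(\<Sum>i\<in>UNIV. W $ j $ i * v k $ i) = (if j = k then 1 else 0)" for j k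
    using arg_cong[OF WV, of "\<lambda>M. M $ j $ k"] by (simp add: V_def matrix_matrix_mult_def mat_def)
  ultimately have "biorthonormal_eigenvectors A lam v (\<lambda>k. W $ k)"
    using v by (simp add: biorthonormal_eigenvectors_def)
  then show ?thesis by blast
qed

section \<open>Spectral calculus\<close>

text \<open>The function \<open>c\<close> serves as a coordinate vector: sums, products and scalar
  multiples of such matrices turn into pointwise operations on \<open>c\<close>.\<close>

definition spectral_sum ::
    "('n::finite \<Rightarrow> complex^'n^'n) \<Rightarrow> ('n \<Rightarrow> complex) \<Rightarrow> complex^'n^'n" where
  "spectral_sum P c = (\<Sum>k\<in>UNIV. cscale (c k) (P k))"

text \<open>\<open>P\<close> is a parameter tied down by an equation because the theorem quantifies
  over \<open>P\<close> in the same way.\<close>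

locale simple_spectrum =
  fixes A :: "complex^'n^'n" and lam :: "'n \<Rightarrow> complex"
    and v phi :: "'n \<Rightarrow> complex^'n" and P :: "'n \<Rightarrow> complex^'n^'n"
  assumes biorthonormal: "biorthonormal_eigenvectors A lam v phi"
    and inj_lam: "inj lam"
    and P_def: "P = spectral_projector v phi"
begin

section \<open>Orthogonality and completeness of the rank-one projectors\<close>

lemma v_eigenvector: "A *v v k = lam k *s v k"
  and phi_v: "(\<Sum>i\<in>UNIV. phi j $ i * v k $ i) = (if j = k then 1 else 0)"
  using biorthonormal by (simp_all add: biorthonormal_eigenvectors_def)

lemma v_nonzero: "v k \<noteq> 0"
  using phi_v[of k k] by auto

lemma P_v: "P j *v v k = (if j = k then v k else 0)"
proof -
  have "P j *v v k = (\<Sum>i\<in>UNIV. phi j $ i * v k $ i) *s v j"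
    by (simp add: P_def spectral_projector_def matrix_vector_mult_def vec_eq_iff
        sum_distrib_left mult_ac)
  then show ?thesis by (simp add: phi_v)
qed

lemma P_mult: "P j ** P k = (if j = k then P k else 0)"
proof -
  have "(P j ** P k) $ a $ b = v j $ a * (\<Sum>i\<in>UNIV. phi j $ i * v k $ i) * phi k $ b" for a b
    by (simp add: P_def spectral_projector_def matrix_matrix_mult_def sum_distrib_left
        sum_distrib_right mult_ac)
  then show ?thesis by (auto simp: vec_eq_iff phi_v) (simp add: P_def spectral_projector_def)
qed

lemma A_mult_P: "A ** P k = cscale (lam k) (P k)"
proof -
  have "(A ** P k) $ a $ b = (A *v v k) $ a * phi k $ b" for a b
    by (simp add: P_def spectral_projector_def matrix_matrix_mult_def matrix_vector_mult_def
        sum_distrib_left mult_ac)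
  then show ?thesis by (simp add: vec_eq_iff v_eigenvector P_def spectral_projector_def)
qed

text \<open>Biorthonormality says \<open>W ** V = mat 1\<close>; the reversed product
  \<open>V ** W\<close>, expanded as columns times rows, is the sum of the projectors.\<close>

lemma sum_P: "(\<Sum>k\<in>UNIV. P k) = mat 1"
proof -
  define V where "V = (\<chi> i k. v k $ i)"
  define W where "W = (\<chi> k i. phi k $ i)"
  have "W ** V = mat 1"
    by (simp add: V_def W_def matrix_matrix_mult_def mat_def vec_eq_iff phi_v)
  then have "V ** W = mat 1"
    using matrix_left_right_inverse by blast
  moreover have "V ** W = (\<Sum>k\<in>UNIV. P k)"
    by (simp add: V_def W_def matrix_matrix_mult_def vec_eq_iff P_def spectral_projector_def)
  ultimately show ?thesis by simp
qed

section \<open>Pointwise calculus of spectral sums\<close>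

lemma spectral_sum_v: "spectral_sum P c *v v k = c k *s v k"
proof -
  have "spectral_sum P c *v v k = (\<Sum>j\<in>UNIV. if j = k then c k *s v k else 0)"
    unfolding spectral_sum_def sum_matrix_vector_mult
    by (rule sum.cong) (auto simp: cscale_matrix_vector_mult P_v)
  then show ?thesis by simp
qed

text \<open>Evaluation at the nonzero vector \<open>v k\<close> recovers the coefficient of mode
  \<open>k\<close>. The uniqueness of representatives and the independence of the projectors rest on
  this.\<close>

lemma spectral_sum_eq_iff: "spectral_sum P c = spectral_sum P d \<longleftrightarrow> c = d"
proof
  assume "spectral_sum P c = spectral_sum P d"
  then have "c k *s v k = d k *s v k" for k
    by (metis spectral_sum_v)
  then show "c = d" using v_nonzero by auto
qed simp

lemma spectral_sum_0: "spectral_sum P (\<lambda>k. 0) = 0"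
  by (simp add: spectral_sum_def)

lemma spectral_sum_1: "spectral_sum P (\<lambda>k. 1) = mat 1"
  by (simp add: spectral_sum_def sum_P)

lemma spectral_sum_single: "spectral_sum P (\<lambda>k. if k = i then 1 else 0) = P i"
proof -
  have "spectral_sum P (\<lambda>k. if k = i then 1 else 0) = (\<Sum>k\<in>UNIV. if k = i then P i else 0)"
    unfolding spectral_sum_def by (rule sum.cong) auto
  then show ?thesis by simp
qed

lemma spectral_sum_add: "spectral_sum P c + spectral_sum P d = spectral_sum P (\<lambda>k. c k + d k)"
  by (simp add: spectral_sum_def cmat.scale_left_distrib sum.distrib)

lemma spectral_sum_cscale: "cscale a (spectral_sum P c) = spectral_sum P (\<lambda>k. a * c k)"
  by (simp add: spectral_sum_def cmat.scale_sum_right)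

text \<open>The projectors are idempotent and mutually annihilating, so all cross terms
  disappear.\<close>

lemma spectral_sum_mult: "spectral_sum P c ** spectral_sum P d = spectral_sum P (\<lambda>k. c k * d k)"
proof -
  have "spectral_sum P c ** P k = cscale (c k) (P k)" for k
  proof -
    have "spectral_sum P c ** P k = (\<Sum>j\<in>UNIV. if j = k then cscale (c k) (P k) else 0)"
      unfolding spectral_sum_def sum_matrix_mult
      by (rule sum.cong) (auto simp: cscale_matrix_mult_left P_mult)
    then show ?thesis by simp
  qed
  then have "spectral_sum P c ** spectral_sum P d = (\<Sum>k\<in>UNIV. cscale (d k) (cscale (c k) (P k)))"
    unfolding spectral_sum_def[of P d] by (simp add: matrix_mult_sum cscale_matrix_mult_right)
  then show ?thesis by (simp add: spectral_sum_def mult.commute)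
qed

lemma spectral_sum_vec: "spectral_sum P c *v y = (\<Sum>k\<in>UNIV. c k *s (P k *v y))"
  by (simp add: spectral_sum_def sum_matrix_vector_mult cscale_matrix_vector_mult)

text \<open>The base case is the completeness relation; each further factor \<open>A\<close> scales
  mode \<open>k\<close> by \<open>lam k\<close>.\<close>

lemma mat_pow_eq: "mat_pow A n = spectral_sum P (\<lambda>k. lam k ^ n)"
proof (induction n)
  case 0
  then show ?case by (simp add: spectral_sum_1)
next
  case (Suc n)
  then show ?case
    by (simp add: spectral_sum_def matrix_mult_sum cscale_matrix_mult_right A_mult_P mult.commute)
qed

lemma mat_poly_eq: "mat_poly p A = spectral_sum P (\<lambda>k. poly p (lam k))"
  unfolding mat_poly_def mat_pow_eq spectral_sum_def
  by (simp add: cmat.scale_sum_right poly_altdef cmat.scale_sum_left) (rule sum.swap)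

text \<open>Distinctness of the eigenvalues enters here: interpolation realises any prescribed
  coefficients by a polynomial.\<close>

lemma poly_algebra_eq: "poly_algebra A = range (spectral_sum P)"
proof -
  have "spectral_sum P c \<in> poly_algebra A" for c
  proof -
    obtain p where "\<And>k. poly p (lam k) = c k"
      using lagrange_interpolation[OF inj_lam, of c] by auto
    then have "mat_poly p A = spectral_sum P c" by (simp add: mat_poly_eq)
    then show ?thesis unfolding poly_algebra_def by (metis rangeI)
  qed
  then show ?thesis by (auto simp: poly_algebra_def mat_poly_eq)
qed

lemma inj_P: "inj P"
proof (rule injI)
  fix i j assume "P i = P j"
  \<comment> \<open>Both projectors are applied to \<open>v i\<close>, which \<open>P i\<close>
    fixes and any other projector sends to 0.\<close>
  then have "(if i = i then v i else 0) = (if j = i then v i else 0)"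
    by (metis P_v)
  then show "i = j" using v_nonzero[of i] by (auto split: if_splits)
qed

section \<open>Basis, dimension and commutativity of the polynomial algebra\<close>

lemma poly_algebra_subspace: "cmat.subspace (poly_algebra A)"
  unfolding cmat.subspace_def poly_algebra_eq
  using spectral_sum_0 by (auto simp: spectral_sum_add spectral_sum_cscale image_iff intro: sym)

lemma span_P: "cmat.span (range P) = poly_algebra A"
proof (rule antisym)
  have "range P \<subseteq> poly_algebra A"
    by (auto simp: poly_algebra_eq simp flip: spectral_sum_single)
  then show "cmat.span (range P) \<subseteq> poly_algebra A"
    by (simp add: cmat.span_minimal poly_algebra_subspace)
  show "poly_algebra A \<subseteq> cmat.span (range P)"
    unfolding poly_algebra_eq spectral_sum_def
    by (blast intro: cmat.span_sum cmat.span_scale cmat.span_base)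
qed

lemma independent_P: "cmat.independent (range P)"
proof -
  have "u w = 0" if "w \<in> range P" "(\<Sum>w\<in>range P. cscale (u w) w) = 0" for u w
  proof -
    \<comment> \<open>Coefficients attached to matrices in \<open>range P\<close> are moved to the
      index set; injectivity of \<open>P\<close> permits the reindexing.\<close>
    have "spectral_sum P (u \<circ> P) = spectral_sum P (\<lambda>k. 0)"
      using that by (simp add: spectral_sum_def sum.reindex[OF inj_P])
    then show ?thesis
      using that by (auto simp: spectral_sum_eq_iff fun_eq_iff)
  qed
  then show ?thesis by (auto simp: cmat.independent_explicit_finite_subsets
    cmat.dependent_finite)
qed

lemma comm_unital_algebra_poly_algebra: "comm_unital_algebra (poly_algebra A)"
  unfolding comm_unital_algebra_def
proof (intro conjI ballI poly_algebra_subspace)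
  show "mat 1 \<in> poly_algebra A"
    unfolding poly_algebra_eq by (metis rangeI spectral_sum_1)
  fix X Y assume "X \<in> poly_algebra A" "Y \<in> poly_algebra A"
  then obtain c d where "X = spectral_sum P c" "Y = spectral_sum P d"
    by (auto simp: poly_algebra_eq)
  then show "X ** Y \<in> poly_algebra A" "X ** Y = Y ** X"
    by (simp_all add: poly_algebra_eq spectral_sum_mult mult.commute)
qed

text \<open>For a simple spectrum each class of indices sharing an eigenvalue is a
  singleton.\<close>

lemma grouped_projector_eq: "grouped_projector lam P (lam k) = P k"
proof -
  have "{j. lam j = lam k} = {k}"
    using inj_lam by (auto simp: inj_eq)
  then show ?thesis by (simp add: grouped_projector_def)
qed

lemma dim_poly_algebra: "cmat.dim (poly_algebra A) = CARD('n)"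
  using cmat.dim_span_eq_card_independent[OF independent_P] inj_P
  by (simp add: span_P card_image)

text \<open>Applying \<open>P i\<close> to any modal expansion returns its \<open>i\<close>-th
  component, so the expanded vector determines all components.\<close>

lemma modal_expansion_unique:
  "unique_modal_expansion P (spectral_sum P c *v y) (\<lambda>k. c k *s (P k *v y))"
  unfolding unique_modal_expansion_def modal_expansion_def
proof (intro conjI allI impI)
  fix k show "c k *s (P k *v y) \<in> range (\<lambda>a. P k *v a)"
    by (metis rangeI vector_scalar_commute)
next
  show "spectral_sum P c *v y = (\<Sum>k\<in>UNIV. c k *s (P k *v y))"
    by (rule spectral_sum_vec)
next
  fix w assume w: "(\<forall>k. w k \<in> range (\<lambda>a. P k *v a)) \<and>
    spectral_sum P c *v y = (\<Sum>k\<in>UNIV. w k)"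
  have proj: "P i *v (\<Sum>k\<in>UNIV. u k) = u i" if u: "\<forall>k. u k \<in> range (\<lambda>a. P k *v a)" for u i
  proof -
    have "P i *v u k = (if k = i then u i else 0)" for k
    proof -
      obtain a where "u k = P k *v a" using u by auto
      then show ?thesis by (auto simp: matrix_vector_mul_assoc P_mult)
    qed
    then show ?thesis by (simp add: matrix_vector_mult_sum)
  qed
  have "\<forall>k. c k *s (P k *v y) \<in> range (\<lambda>a. P k *v a)"
    by (metis rangeI vector_scalar_commute)
  then have "w i = c i *s (P i *v y)" for i
    using proj[of w i] proj[of "\<lambda>k. c k *s (P k *v y)" i] w by (simp add: spectral_sum_vec)
  then show "w = (\<lambda>k. c k *s (P k *v y))" by auto
qed

text \<open>The premise determines \<open>R\<close> among all matrices, which is more than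
  uniqueness inside the algebra; uniqueness of the coefficients is
  \<open>spectral_sum_eq_iff\<close>.\<close>

lemma unique_representativeI:
  assumes "\<And>R. rep R \<longleftrightarrow> R = spectral_sum P c"
  shows "unique_representative (poly_algebra A) P rep c"
  unfolding unique_representative_def spectral_sum_def[symmetric]
  by (rule bexI[of _ "spectral_sum P c"])
    (auto simp: assms poly_algebra_eq spectral_sum_eq_iff)

end

section \<open>The evaluation map\<close>

text \<open>\<open>\<sigma>\<close> translates the enumeration of distinct eigenvalues by
  \<open>'r\<close> into the indices of the list \<open>lam\<close>.\<close>

locale enumerated_simple_spectrum = simple_spectrum A lam v phi P
  for A :: "complex^'n^'n" and lam v phi P +
  fixes eig :: "'r::finite \<Rightarrow> complex" and \<sigma> :: "'r \<Rightarrow> 'n"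
  assumes bij_sigma: "bij \<sigma>" and eig_eq: "eig j = lam (\<sigma> j)"
begin

text \<open>The choice inside \<open>eval_map\<close> is harmless: every polynomial representing the
  matrix takes the value \<open>c k\<close> at \<open>lam k\<close>.\<close>

lemma eval_map_spectral_sum: "eval_map A eig (spectral_sum P c) = (\<chi> j. c (\<sigma> j))"
proof -
  have "\<exists>p. mat_poly p A = spectral_sum P c"
    using poly_algebra_eq unfolding poly_algebra_def by (metis (mono_tags) imageE rangeI)
  then have "mat_poly (SOME p. mat_poly p A = spectral_sum P c) A = spectral_sum P c"
    by (rule someI_ex)
  then have "(\<lambda>k. poly (SOME p. mat_poly p A = spectral_sum P c) (lam k)) = c"
    by (simp add: mat_poly_eq spectral_sum_eq_iff)
  then show ?thesis
    by (auto simp: eval_map_def vec_eq_iff eig_eq fun_eq_iff)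
qed

lemma eval_map_mat_poly: "eval_map A eig (mat_poly p A) = (\<chi> j. poly p (eig j))"
  by (simp add: mat_poly_eq eval_map_spectral_sum eig_eq)

lemma bij_betw_eval_map: "bij_betw (eval_map A eig) (poly_algebra A) UNIV"
  unfolding bij_betw_def
proof
  have "c = d" if "\<And>j. c (\<sigma> j) = d (\<sigma> j)" for c d :: "'n \<Rightarrow> complex"
    using that bij_sigma by (metis bij_pointE ext)
  then show "inj_on (eval_map A eig) (poly_algebra A)"
    by (auto simp: inj_on_def poly_algebra_eq eval_map_spectral_sum vec_eq_iff spectral_sum_eq_iff)
  have "w = eval_map A eig (spectral_sum P (\<lambda>k. w $ inv \<sigma> k))" for w
    using bij_sigma by (simp add: eval_map_spectral_sum vec_eq_iff bij_is_inj)
  then show "eval_map A eig ` poly_algebra A = UNIV"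
    by (auto simp: poly_algebra_eq image_iff)
qed

lemma algebra_iso_eval_map: "algebra_iso (poly_algebra A) (eval_map A eig)"
  unfolding algebra_iso_def
  by (auto simp: bij_betw_eval_map[unfolded poly_algebra_eq] poly_algebra_eq eval_map_spectral_sum spectral_sum_add
      spectral_sum_mult spectral_sum_cscale vec_eq_iff simp flip: spectral_sum_1)

text \<open>The right-hand side lies in the algebra and evaluates to the conjugated vector;
  injectivity of the evaluation map makes it the preimage.\<close>

lemma pullback_cnj_spectral_sum:
  "pullback_cnj (poly_algebra A) (eval_map A eig) (spectral_sum P c) = spectral_sum P (\<lambda>k. cnj (c k))"
  unfolding pullback_cnj_def
  by (rule the_inv_into_f_eq[OF bij_betw_imp_inj_on[OF bij_betw_eval_map]])
    (auto simp: eval_map_spectral_sum vec_cnj_def poly_algebra_eq)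

lemma algebra_involution_pullback_cnj:
  "algebra_involution (poly_algebra A) (pullback_cnj (poly_algebra A) (eval_map A eig))"
  unfolding algebra_involution_def
  by (auto simp: poly_algebra_eq pullback_cnj_spectral_sum[unfolded poly_algebra_eq]
      spectral_sum_add spectral_sum_mult spectral_sum_cscale mult.commute)

lemma star_algebra_iso_eval_map:
  "star_algebra_iso (poly_algebra A) (pullback_cnj (poly_algebra A) (eval_map A eig))
     (eval_map A eig)"
  unfolding star_algebra_iso_def using algebra_iso_eval_map
  by (auto simp: poly_algebra_eq pullback_cnj_spectral_sum[unfolded poly_algebra_eq]
      eval_map_spectral_sum vec_cnj_def)

lemma span_grouped_projectors:
  "cmat.span (range (\<lambda>j. grouped_projector lam P (eig j))) = poly_algebra A"
proof -
  have "range (\<lambda>j. grouped_projector lam P (eig j)) = P ` range \<sigma>"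
    by (auto simp: eig_eq grouped_projector_eq)
  then show ?thesis
    using bij_sigma by (simp add: bij_is_surj span_P)
qed

end

section \<open>Interventions\<close>

lemma lifted_flow_eq: "lifted_flow A n z = mat_pow A n *v z"
  by (induction n) (simp_all add: matrix_vector_mul_assoc)

text \<open>Linearity cancels the unperturbed trajectory, so the effect does not depend on
  \<open>z\<close>.\<close>

lemma downstream_effect_eq: "downstream_effect A l0 l z \<delta> = mat_pow A (l - l0) *v \<delta>"
  by (simp add: downstream_effect_def lifted_flow_eq matrix_vector_right_distrib)

lemma represents_attribution_iff:
  "represents_attribution TYPE('q::finite) A l0 l R \<longleftrightarrow> R = mat_pow A (l - l0)"
  for A :: "complex^'n^'n"
proof
  assume R: "represents_attribution TYPE('q) A l0 l R"
  have "(R *v \<delta>) $ i = (mat_pow A (l - l0) *v \<delta>) $ i" for \<delta> i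
  proof -
    \<comment> \<open>This read-out copies coordinate \<open>i\<close> to every output, so read-outs
      separate vectors whatever the size of \<open>'q\<close>.\<close>
    define C :: "complex^'n^'q" where "C = (\<chi> q j. if j = i then 1 else 0)"
    have C: "(C *v y) $ q = y $ i" for y q
      by (simp add: C_def matrix_vector_mult_def if_distrib[of "\<lambda>x. x * _"] cong: if_cong)
    have "C *v (mat_pow A (l - l0) *v \<delta>) = C *v (R *v \<delta>)"
      using R by (simp add: represents_attribution_def attribution_effect_def)
    then show ?thesis using C by metis
  qed
  then show "R = mat_pow A (l - l0)"
    by (simp add: matrix_eq vec_eq_iff)
qed (simp add: represents_attribution_def attribution_effect_def)

context simple_spectrum
begin

lemma path_patch_eq: "path_patch P S \<delta> = spectral_sum P (\<lambda>k. if k \<in> S then 1 else 0) *v \<delta>"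
proof -
  have "spectral_sum P (\<lambda>k. if k \<in> S then 1 else 0) *v \<delta> =
      (\<Sum>k\<in>UNIV. if k \<in> S then P k *v \<delta> else 0)"
    unfolding spectral_sum_vec by (rule sum.cong) auto
  then show ?thesis
    by (simp add: path_patch_def flip: sum.inter_filter)
qed

text \<open>Selecting modes and propagating are both spectral sums, so the indicator of
  \<open>S\<close> multiplies the powers of the eigenvalues.\<close>

lemma downstream_path_patch:
  "downstream_effect A l0 l z (path_patch P S \<delta>) =
     spectral_sum P (\<lambda>k. if k \<in> S then lam k ^ (l - l0) else 0) *v \<delta>"
proof -
  have "(\<lambda>k. lam k ^ (l - l0) * (if k \<in> S then 1 else 0)) =
      (\<lambda>k. if k \<in> S then lam k ^ (l - l0) else 0)"
    by auto
  then show ?thesis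
    by (simp add: downstream_effect_eq path_patch_eq mat_pow_eq matrix_vector_mul_assoc
        spectral_sum_mult)
qed

lemma represents_patching_representative:
  "unique_representative (poly_algebra A) P (represents_patching A l0 l) (\<lambda>k. lam k ^ (l - l0))"
  by (rule unique_representativeI)
    (auto simp: represents_patching_def downstream_effect_eq matrix_eq mat_pow_eq)

lemma represents_path_patching_representative:
  "unique_representative (poly_algebra A) P (represents_path_patching A P S l0 l)
     (\<lambda>k. if k \<in> S then lam k ^ (l - l0) else 0)"
  by (rule unique_representativeI)
    (auto simp: represents_path_patching_def downstream_path_patch matrix_eq)

lemma represents_attribution_representative:
  "unique_representative (poly_algebra A) P (represents_attribution TYPE('q::finite) A l0 l)
     (\<lambda>k. lam k ^ (l - l0))"
  by (rule unique_representativeI) (simp add: represents_attribution_iff mat_pow_eq)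

lemma unique_modal_expansion_downstream:
  "unique_modal_expansion P (downstream_effect A l0 l z \<delta>) (\<lambda>k. lam k ^ (l - l0) *s (P k *v \<delta>))"
  unfolding downstream_effect_eq mat_pow_eq by (rule modal_expansion_unique)

lemma unique_modal_expansion_path_patch:
  "unique_modal_expansion P (downstream_effect A l0 l z (path_patch P S \<delta>))
     (\<lambda>k. (if k \<in> S then lam k ^ (l - l0) else 0) *s (P k *v \<delta>))"
  unfolding downstream_path_patch by (rule modal_expansion_unique)

lemma unique_modal_expansion_self: "unique_modal_expansion P \<delta> (\<lambda>k. P k *v \<delta>)"
  using modal_expansion_unique[of "\<lambda>k. 1" \<delta>] by (simp add: spectral_sum_1)

lemma attribution_effect_eq:
  "attribution_effect A C l0 l \<delta> = (\<Sum>k\<in>UNIV. lam k ^ (l - l0) *s ((C ** P k) *v \<delta>))"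
  by (simp add: attribution_effect_def mat_pow_eq spectral_sum_vec matrix_vector_mult_sum
      vector_scalar_commute matrix_vector_mul_assoc)

end

theorem theorem9p2:
  fixes X U :: "(real^'d) set"
    and \<mu> \<nu> :: "(real^'d) measure"
    and mlp :: "real^'d \<Rightarrow> real^'d" and gain :: "real^'d" and eps :: real
    and F :: "real^'d \<Rightarrow> real^'d \<Rightarrow> real^'d"
    and Psi :: "real^'d \<Rightarrow> complex^'n"
    and A :: "complex^'n^'n"
    and lam :: "'n \<Rightarrow> complex" and \<Delta> :: real
    and eig :: "'r::finite \<Rightarrow> complex"
  assumes "prob_space \<mu>" and "sets \<mu> = sets (restrict_space borel X)"
    and "prob_space \<nu>" and "sets \<nu> = sets (restrict_space borel U)"
    and "F = layer_map mlp gain eps" and "eps \<ge> 0"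
    and "\<forall>x\<in>X. \<forall>u\<in>U. F x u \<in> X"
    and "square_integrable_obs \<mu> Psi"
    and invariant: "koopman_invariant \<mu> U F Psi"
    and R1: "pos_definite (gram \<mu> Psi)"
    and R2: "uncorrelated_centred_control \<mu> \<nu> Psi"
    and realisation: "koopman_realisation \<mu> \<nu> F Psi A"
    and "eigenvalue_list A lam"
    and "\<Delta> > 0" and gap: "\<forall>i j. i \<noteq> j \<longrightarrow> cmod (lam i - lam j) \<ge> \<Delta>"
    and distinct_eigenvalues: "inj eig" "range eig = spectrum A"
  shows
    "(\<exists>v phi. biorthonormal_eigenvectors A lam v phi) \<and>
     (\<forall>v phi P. biorthonormal_eigenvectors A lam v phi \<longrightarrow> P = spectral_projector v phi \<longrightarrow>
        \<comment> \<open>(a)\<close>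
        (comm_unital_algebra (poly_algebra A) \<and>
         cmat.dim (poly_algebra A) = CARD('r) \<and>
         cmat.span (range (\<lambda>j. grouped_projector lam P (eig j))) = poly_algebra A) \<and>
        \<comment> \<open>(b)\<close>
        ((\<forall>p. eval_map A eig (mat_poly p A) = (\<chi> j. poly p (eig j))) \<and>
         algebra_iso (poly_algebra A) (eval_map A eig) \<and>
         algebra_involution (poly_algebra A) (pullback_cnj (poly_algebra A) (eval_map A eig)) \<and>
         star_algebra_iso (poly_algebra A)
           (pullback_cnj (poly_algebra A) (eval_map A eig)) (eval_map A eig)) \<and>
        \<comment> \<open>(c)\<close>
        (\<forall>l0 l z \<delta>. l0 < l \<longrightarrow>
           downstream_effect A l0 l z \<delta> = mat_pow A (l - l0) *v \<delta> \<and>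
           mat_pow A (l - l0) *v \<delta> = (\<Sum>k\<in>UNIV. lam k ^ (l - l0) *s (P k *v \<delta>))) \<and>
        \<comment> \<open>(d)\<close>
        (inj P \<and> cmat.independent (range P) \<and> cmat.span (range P) = poly_algebra A) \<and>
        (\<forall>\<delta>. unique_modal_expansion P \<delta> (\<lambda>k. P k *v \<delta>)) \<and>
        (\<forall>l0 l. l0 < l \<longrightarrow>
           \<comment> \<open>activation patching\<close>
           (unique_representative (poly_algebra A) P
              (represents_patching A l0 l) (\<lambda>k. lam k ^ (l - l0)) \<and>
            (\<forall>x\<in>X. \<forall>x'\<in>X.
               unique_modal_expansion P
                 (downstream_effect A l0 l (Psi x) (activation_patch Psi x x'))
                 (\<lambda>k. lam k ^ (l - l0) *s (P k *v activation_patch Psi x x')))) \<and>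
           \<comment> \<open>path patching\<close>
           (\<forall>S. unique_representative (poly_algebra A) P
              (represents_path_patching A P S l0 l)
              (\<lambda>k. if k \<in> S then lam k ^ (l - l0) else 0) \<and>
            (\<forall>x\<in>X. \<forall>\<delta>.
               unique_modal_expansion P
                 (downstream_effect A l0 l (Psi x) (path_patch P S \<delta>))
                 (\<lambda>k. (if k \<in> S then lam k ^ (l - l0) else 0) *s (P k *v \<delta>)))) \<and>
           \<comment> \<open>attribution patching\<close>
           (unique_representative (poly_algebra A) P
              (represents_attribution TYPE('q::finite) A l0 l) (\<lambda>k. lam k ^ (l - l0)) \<and>
            (\<forall>(C :: complex^'n^'q) \<delta>.
               attribution_effect A C l0 l \<delta> =
                 (\<Sum>k\<in>UNIV. lam k ^ (l - l0) *s ((C ** P k) *v \<delta>)))) \<and>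
           \<comment> \<open>mean ablation\<close>
           (unique_representative (poly_algebra A) P
              (represents_patching A l0 l) (\<lambda>k. lam k ^ (l - l0)) \<and>
            (\<forall>x\<in>X.
               unique_modal_expansion P
                 (downstream_effect A l0 l (Psi x) (mean_ablation \<mu> Psi x))
                 (\<lambda>k. lam k ^ (l - l0) *s (P k *v mean_ablation \<mu> Psi x))))))"
proof -
  have inj_lam: "inj lam"
  proof (rule injI, rule ccontr)
    fix i j assume "lam i = lam j" "i \<noteq> j"
    then show False using gap \<open>\<Delta> > 0\<close> by fastforce
  qed
  have range_eig: "range eig = range lam"
    using distinct_eigenvalues spectrum_eq_range_eigenvalue_list[OF \<open>eigenvalue_list A lam\<close>] by simp
  \<comment> \<open>\<open>\<sigma> j\<close> is the position of \<open>eig j\<close> in the list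
    \<open>lam\<close>; both families have the same range and no repetitions, which makes it a
    bijection.\<close>
  define \<sigma> where "\<sigma> j = inv lam (eig j)" for j
  have eig: "eig j = lam (\<sigma> j)" for j
    using range_eig unfolding \<sigma>_def by (metis f_inv_into_f rangeI)
  have "inj \<sigma>"
    using distinct_eigenvalues(1) eig by (metis inj_def)
  moreover have "k \<in> range \<sigma>" for k
    using range_eig eig inj_lam by (metis imageE inj_eq rangeI)
  ultimately have bij: "bij \<sigma>"
    by (auto simp: bij_def)
  have card: "CARD('n) = CARD('r)"
    using bij_betw_same_card[OF bij] by simp
  show ?thesis
  proof (intro conjI[OF biorthonormal_eigenvectors_exist] allI impI, goal_cases)
    \<comment> \<open>Cases 1 and 2 are the premises of
      \<open>biorthonormal_eigenvectors_exist\<close>, closed by the final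
      \<open>fact+\<close>.\<close>
    case (3 v phi P)
    then interpret enumerated_simple_spectrum A lam v phi P eig \<sigma>
      by unfold_locales (use inj_lam bij eig in auto)
    have mat_pow_vec: "mat_pow A m *v \<delta> = (\<Sum>k\<in>UNIV. lam k ^ m *s (P k *v \<delta>))" for m \<delta>
      by (simp add: mat_pow_eq spectral_sum_vec)
    note facts = mat_pow_vec comm_unital_algebra_poly_algebra dim_poly_algebra[unfolded card]
      span_grouped_projectors eval_map_mat_poly algebra_iso_eval_map
      algebra_involution_pullback_cnj star_algebra_iso_eval_map
      downstream_effect_eq inj_P independent_P span_P unique_modal_expansion_self
      represents_patching_representative represents_path_patching_representative
      represents_attribution_representative unique_modal_expansion_downstream
      unique_modal_expansion_path_patch attribution_effect_eq
    \<comment> \<open>Activation patching and mean ablation are instances of the expansion for an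
      arbitrary \<open>\<delta>\<close>.\<close>
    show ?case
      by (intro conjI allI impI ballI) (rule facts)+
  qed fact+
qed

end
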